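(* Let $f\in\mathbb{R}[X_1,\dots,X_n]$, $h\in\mathbb{R}^n$, and let $g=\sum_{\alpha\in J}b_\alpha(X-h)^{2\alpha}\in\mathscr{C}(h)$ be a feasible solution to the sos program (GLOB) for some $J$. Then 1. $g(\lfloor h\rceil)\le\inf_{x\in\mathbb{Z}^n}f(x)$. If moreover $f-f(h)\in\Sigma$ holds and $g$ is an optimal solution to (GLOB), then 2. $g(\lfloor h\rceil)\ge f(h)$.
   Context: $\Sigma$ is the set of polynomials in $\mathbb{R}[X_1,\dots,X_n]$ that are finite sums of squares of polynomials in $\mathbb{R}[X_1,\dots,X_n]$ ("sos"). $(X-h)^{2\alpha}:=\prod_{j=1}^n(X_j-h_j)^{2\alpha_j}$. $\mathscr{C}(h)$ is the set of all polynomials $\sum_{\alpha\in J}b_\alpha(X-h)^{2\alpha}$ with $J\subset\mathbb{N}_0^n$ finite, $b_\alpha\in\mathbb{R}$, and $b_\alpha\ge0$ for all $\alpha\neq0$. For $h\in\mathbb{R}^n$, $\lfloor h\rceil\in\mathbb{Z}^n$ is obtained by rounding each component to its nearest integer, and $w_\alpha:=(\lfloor h\rceil-h)^{2\alpha}$ is the value of $(X-h)^{2\alpha}$ at $\lfloor h\rceil$. For given $f$, $h$ and finite $J\subset\mathbb{N}_0^n$, (GLOB) is the program with real decision variables $b_\alpha$, $\alpha\in J$: $$\max\ \sum_{\alpha\in J}w_\alpha b_\alpha\quad\text{s.t.}\quad f-\sum_{\alpha\in J}b_\alpha(X-h)^{2\alpha}\in\Sigma,\qquad b_\alpha\in\Sigma\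 \text{(equivalently } b_\alpha\ge0)\ \text{ for }\alpha\neq0.$$ A solution $(b_\alpha)_{\alpha\in J}$ is identified with the polynomial $g=\sum_{\alpha\in J}b_\alpha(X-h)^{2\alpha}$ it defines; its objective value is $g(\lfloor h\rceil)$.
   Formalization: Part 2 is stated with the added assumption 0 ∈ J (the free constant term b_0 is present in (GLOB)); without it the claim fails, e.g. n=1, h=0, f=X²+1, J={1}, where every feasible g has g(0)=0<1=f(0). *)

theory Defs
  imports "HOL-Analysis.Analysis" "HOL-Library.Poly_Mapping"
begin

text \<open>Multi-indices over a finite index type, and real polynomials as finitely supported
  coefficient functions on multi-indices. Ring operations are those of \<^theory>\<open>HOL-Library.Poly_Mapping\<close>.\<close>

type_synonym 'n mindex = "'n \<Rightarrow>\<^sub>0 nat"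

type_synonym 'n rpoly = "'n mindex \<Rightarrow>\<^sub>0 real"

definition const_poly :: "real \<Rightarrow> 'n rpoly" where
  "const_poly c = Poly_Mapping.single 0 c"

definition var_poly :: "'n \<Rightarrow> 'n rpoly" where
  "var_poly j = Poly_Mapping.single (Poly_Mapping.single j 1) 1"

definition eval_poly :: "'n::finite rpoly \<Rightarrow> real ^ 'n \<Rightarrow> real" where
  "eval_poly p x = (\<Sum>m\<in>Poly_Mapping.keys p.
     Poly_Mapping.lookup p m * (\<Prod>j\<in>UNIV. (x $ j) ^ Poly_Mapping.lookup m j))"

definition sos :: "'n::finite rpoly set" where
  "sos = {p. \<exists>qs :: 'n rpoly list. p = (\<Sum>q\<leftarrow>qs. q ^ 2)}"

definition even_power :: "real ^ 'n \<Rightarrow> 'n::finite mindex \<Rightarrow> 'n rpoly" where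
  "even_power h \<alpha> = (\<Prod>j\<in>UNIV. (var_poly j - const_poly (h $ j)) ^ (2 * Poly_Mapping.lookup \<alpha> j))"

definition even_comb :: "real ^ 'n \<Rightarrow> 'n::finite mindex set \<Rightarrow> ('n mindex \<Rightarrow> real) \<Rightarrow> 'n rpoly" where
  "even_comb h J b = (\<Sum>\<alpha>\<in>J. const_poly (b \<alpha>) * even_power h \<alpha>)"

definition C_set :: "real ^ 'n \<Rightarrow> 'n::finite rpoly set" where
  "C_set h = {even_comb h J b | J b. finite J \<and> (\<forall>\<alpha>\<in>J. \<alpha> \<noteq> 0 \<longrightarrow> b \<alpha> \<ge> 0)}"

text \<open>Ties are rounded up, the convention of \<^const>\<open>round\<close>.\<close>

definition round_vec :: "real ^ 'n \<Rightarrow> real ^ 'n" where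
  "round_vec h = (\<chi> j. of_int (round (h $ j)))"

definition int_points :: "(real ^ 'n) set" where
  "int_points = {x. \<forall>j. x $ j \<in> \<int>}"

definition weight :: "real ^ 'n \<Rightarrow> 'n::finite mindex \<Rightarrow> real" where
  "weight h \<alpha> = (\<Prod>j\<in>UNIV. (round_vec h $ j - h $ j) ^ (2 * Poly_Mapping.lookup \<alpha> j))"

text \<open>The program (GLOB) for given \<open>f\<close>, \<open>h\<close>, \<open>J\<close>. Only the values of \<open>b\<close> on \<open>J\<close> matter.\<close>

definition glob_objective :: "real ^ 'n \<Rightarrow> 'n::finite mindex set \<Rightarrow> ('n mindex \<Rightarrow> real) \<Rightarrow> real" where
  "glob_objective h J b = (\<Sum>\<alpha>\<in>J. weight h \<alpha> * b \<alpha>)"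

definition glob_feasible ::
  "'n::finite rpoly \<Rightarrow> real ^ 'n \<Rightarrow> 'n mindex set \<Rightarrow> ('n mindex \<Rightarrow> real) \<Rightarrow> bool" where
  "glob_feasible f h J b \<longleftrightarrow>
     f - even_comb h J b \<in> sos \<and> (\<forall>\<alpha>\<in>J. \<alpha> \<noteq> 0 \<longrightarrow> (const_poly (b \<alpha>) :: 'n rpoly) \<in> sos)"

definition glob_optimal ::
  "'n::finite rpoly \<Rightarrow> real ^ 'n \<Rightarrow> 'n mindex set \<Rightarrow> ('n mindex \<Rightarrow> real) \<Rightarrow> bool" where
  "glob_optimal f h J b \<longleftrightarrow>
     glob_feasible f h J b \<and>
     (\<forall>b'. glob_feasible f h J b' \<longrightarrow> glob_objective h J b' \<le> glob_objective h J b)"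

end

theory Submission
  imports Defs
begin

text \<open>
  Both inequalities are statements about values of polynomials, so they follow once evaluation
  at a point is known to be a ring homomorphism: a sum of squares is then nonnegative everywhere,
  and \<^term>\<open>even_comb h J b\<close> takes the value \<open>\<Sum>\<alpha>\<in>J. b \<alpha> * (\<Prod>j. (x\<^sub>j - h\<^sub>j) ^ (2\<alpha>\<^sub>j))\<close>.

  The lower bound combines two comparisons at an integer point \<open>x\<close>. Feasibility says that
  \<open>f - g\<close> is a sum of squares, so \<open>g x \<le> f x\<close>. Rounding minimises every single distance
  \<open>\<bar>x\<^sub>j - h\<^sub>j\<bar>\<close> over the integers, hence it minimises every product \<open>\<Prod>j. (x\<^sub>j - h\<^sub>j) ^ (2\<alpha>\<^sub>j)\<close>;
  since the coefficients \<open>b \<alpha>\<close> with \<open>\<alpha> \<noteq> 0\<close> are nonnegative and the product for \<open>\<alpha> = 0\<close> is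
  constant, it minimises \<open>g\<close> as well (\<open>eval_even_comb_round_le\<close>).

  For the second inequality, the objective of the program is the value of \<open>g\<close> at the rounded point
  (\<open>eval_even_comb_round\<close>), so an optimal \<open>g\<close> only has to be compared with one feasible competitor.
  The hypothesis that \<open>f - f h\<close> is a sum of squares makes the constant polynomial \<open>f h\<close> feasible,
  and its objective value is \<open>f h\<close>.
\<close>

section \<open>Evaluation is a ring homomorphism\<close>

definition eval_monom :: "'n::finite mindex \<Rightarrow> real ^ 'n \<Rightarrow> real" where
  "eval_monom m x = (\<Prod>j\<in>UNIV. (x $ j) ^ Poly_Mapping.lookup m j)"

lemma eval_monom_add: "eval_monom (m + k) x = eval_monom m x * eval_monom k x"
  by (simp add: eval_monom_def lookup_add power_add prod.distrib)

text \<open>Sums over different key sets can only be combined after enlarging both to a common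
  index set.\<close>

lemma eval_poly_superset:
  assumes "finite S" "Poly_Mapping.keys p \<subseteq> S"
  shows "eval_poly p x = (\<Sum>m\<in>S. Poly_Mapping.lookup p m * eval_monom m x)"
  unfolding eval_poly_def eval_monom_def
  by (rule sum.mono_neutral_left) (use assms in \<open>auto simp: in_keys_iff\<close>)

lemma eval_poly_add: "eval_poly (p + q) x = eval_poly p x + eval_poly q x"
proof -
  let ?S = "Poly_Mapping.keys p \<union> Poly_Mapping.keys q"
  have "Poly_Mapping.keys (p + q) \<subseteq> ?S"
    by (rule keys_add)
  then show ?thesis
    by (simp add: eval_poly_superset[of ?S] lookup_add distrib_right sum.distrib)
qed

lemma eval_poly_zero [simp]: "eval_poly 0 x = 0"
  by (simp add: eval_poly_def)

lemma eval_poly_diff: "eval_poly (p - q) x = eval_poly p x - eval_poly q x"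
  using eval_poly_add[of "p - q" q x] by simp

lemma eval_poly_single: "eval_poly (Poly_Mapping.single m c) x = c * eval_monom m x"
  by (simp add: eval_poly_superset[of "{m}"])

lemma eval_poly_const [simp]: "eval_poly (const_poly c) x = c"
  by (simp add: const_poly_def eval_poly_single eval_monom_def)

lemma eval_poly_var [simp]: "eval_poly (var_poly i) x = x $ i"
proof -
  have "(\<Prod>j\<in>UNIV. (x $ j) ^ Poly_Mapping.lookup (Poly_Mapping.single i 1) j)
      = (\<Prod>j\<in>UNIV. if i = j then x $ j else 1)"
    by (intro prod.cong) (auto simp: lookup_single)
  then show ?thesis
    by (simp add: var_poly_def eval_poly_single eval_monom_def)
qed

lemma const_poly_0 [simp]: "const_poly 0 = 0"
  by (simp add: const_poly_def)

lemma const_poly_1: "const_poly 1 = 1"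
  by (simp add: const_poly_def)

lemma eval_poly_one [simp]: "eval_poly 1 x = 1"
  using eval_poly_const[of 1 x] by (simp add: const_poly_1)

lemma rpoly_induct [case_names zero single_add]:
  assumes "P 0"
    and "\<And>m c p. P p \<Longrightarrow> P (Poly_Mapping.single m c + p)"
  shows "P (p :: 'n rpoly)"
proof (induction p rule: update_induct)
  case const
  show ?case
    by (rule assms(1))
next
  case (update p m c)
  have "Poly_Mapping.update m c p = Poly_Mapping.single m c + p"
    by (rule poly_mapping_eqI)
       (use update in \<open>auto simp: lookup_add lookup_single lookup_update in_keys_iff when_def\<close>)
  then show ?case
    using assms(2) update by simp
qed

lemma eval_poly_single_mult:
  "eval_poly (Poly_Mapping.single m c * q) x = c * eval_monom m x * eval_poly q x"
  by (induction q rule: rpoly_induct)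
     (simp_all add: distrib_left eval_poly_add mult_single eval_poly_single eval_monom_add)

lemma eval_poly_mult: "eval_poly (p * q) x = eval_poly p x * eval_poly q x"
  by (induction p rule: rpoly_induct)
     (simp_all add: distrib_right eval_poly_add eval_poly_single eval_poly_single_mult)

lemma eval_poly_power: "eval_poly (p ^ k) x = eval_poly p x ^ k"
  by (induction k) (simp_all add: eval_poly_mult)

lemma eval_poly_sum: "eval_poly (\<Sum>i\<in>A. p i) x = (\<Sum>i\<in>A. eval_poly (p i) x)"
  by (induction A rule: infinite_finite_induct) (simp_all add: eval_poly_add)

lemma eval_poly_prod: "eval_poly (\<Prod>i\<in>A. p i) x = (\<Prod>i\<in>A. eval_poly (p i) x)"
  by (induction A rule: infinite_finite_induct) (simp_all add: eval_poly_mult)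

section \<open>Sums of squares and the polynomials of the program\<close>

lemma sos_nonneg:
  assumes "p \<in> sos"
  shows "0 \<le> eval_poly p x"
proof -
  have "0 \<le> eval_poly (\<Sum>q\<leftarrow>qs. q ^ 2) x" for qs
    by (induction qs) (simp_all add: eval_poly_add eval_poly_power)
  then show ?thesis
    using assms by (auto simp: sos_def)
qed

lemma zero_in_sos: "0 \<in> sos"
  unfolding sos_def by (auto intro: exI[of _ "[]"])

lemma const_sos_nonneg: "(const_poly c :: 'n::finite rpoly) \<in> sos \<Longrightarrow> 0 \<le> c"
  using sos_nonneg[of "const_poly c" "0 :: real ^ 'n"] by simp

lemma eval_even_power:
  "eval_poly (even_power h \<alpha>) x = (\<Prod>j\<in>UNIV. (x $ j - h $ j) ^ (2 * Poly_Mapping.lookup \<alpha> j))"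
  by (simp add: even_power_def eval_poly_prod eval_poly_power eval_poly_diff)

lemma eval_even_comb:
  "eval_poly (even_comb h J b) x = (\<Sum>\<alpha>\<in>J. b \<alpha> * eval_poly (even_power h \<alpha>) x)"
  by (simp add: even_comb_def eval_poly_sum eval_poly_mult)

lemma eval_even_comb_round: "eval_poly (even_comb h J b) (round_vec h) = glob_objective h J b"
  by (simp add: eval_even_comb eval_even_power glob_objective_def weight_def mult.commute)

section \<open>Rounding minimises over the integer points\<close>

text \<open>The exponents are even, so each factor is monotone in the distance of \<open>x\<^sub>j\<close> to \<open>h\<^sub>j\<close>, and
  among integers that distance is smallest for the rounded coordinate.\<close>

lemma eval_even_power_round_le:
  assumes "x \<in> int_points"
  shows "eval_poly (even_power h \<alpha>) (round_vec h) \<le> eval_poly (even_power h \<alpha>) x"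
  unfolding eval_even_power
proof (intro prod_mono conjI)
  fix j
  obtain k where k: "x $ j = of_int k"
    using assms by (auto simp: int_points_def elim: Ints_cases)
  have "\<bar>round_vec h $ j - h $ j\<bar> \<le> \<bar>x $ j - h $ j\<bar>"
    using round_diff_minimal[of "h $ j" k] by (simp add: round_vec_def k abs_minus_commute)
  then have "(round_vec h $ j - h $ j)\<^sup>2 \<le> (x $ j - h $ j)\<^sup>2"
    by (simp add: abs_le_square_iff)
  then show "(round_vec h $ j - h $ j) ^ (2 * Poly_Mapping.lookup \<alpha> j)
      \<le> (x $ j - h $ j) ^ (2 * Poly_Mapping.lookup \<alpha> j)"
    by (simp add: power_mult power_mono)
qed simp

text \<open>A coefficient of arbitrary sign at \<open>\<alpha> = 0\<close> is harmless: it contributes the same constant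
  at both points.\<close>

lemma eval_even_comb_round_le:
  assumes "x \<in> int_points" and "\<And>\<alpha>. \<alpha> \<in> J \<Longrightarrow> \<alpha> \<noteq> 0 \<Longrightarrow> 0 \<le> b \<alpha>"
  shows "eval_poly (even_comb h J b) (round_vec h) \<le> eval_poly (even_comb h J b) x"
  unfolding eval_even_comb
proof (rule sum_mono)
  fix \<alpha> assume "\<alpha> \<in> J"
  show "b \<alpha> * eval_poly (even_power h \<alpha>) (round_vec h) \<le> b \<alpha> * eval_poly (even_power h \<alpha>) x"
  proof (cases "\<alpha> = 0")
    case True
    then show ?thesis by (simp add: eval_even_power)
  next
    case False
    then show ?thesis
      using assms \<open>\<alpha> \<in> J\<close> by (intro mult_left_mono eval_even_power_round_le) auto
  qed
qed

section \<open>The bounds given by the program\<close>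

lemma glob_feasible_lower_bound:
  assumes "glob_feasible f h J b" and "x \<in> int_points"
  shows "eval_poly (even_comb h J b) (round_vec h) \<le> eval_poly f x"
proof -
  have "eval_poly (even_comb h J b) (round_vec h) \<le> eval_poly (even_comb h J b) x"
    using assms by (intro eval_even_comb_round_le) (auto simp: glob_feasible_def dest: const_sos_nonneg)
  also have "\<dots> \<le> eval_poly f x"
    using sos_nonneg[of "f - even_comb h J b" x] assms(1)
    by (simp add: glob_feasible_def eval_poly_diff)
  finally show ?thesis .
qed

lemma even_comb_constant:
  assumes "finite J" "0 \<in> J"
  shows "even_comb h J (\<lambda>\<alpha>. if \<alpha> = 0 then c else 0) = const_poly c"
proof -
  have "even_comb h J (\<lambda>\<alpha>. if \<alpha> = 0 then c else 0)
      = (\<Sum>\<alpha>\<in>J. if \<alpha> = 0 then const_poly c else 0)"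
    unfolding even_comb_def by (intro sum.cong) (auto simp: even_power_def)
  then show ?thesis
    using assms by simp
qed

text \<open>The constant polynomial \<open>c\<close> is itself a feasible competitor, with objective value \<open>c\<close>. The
  index \<open>0\<close> must be in \<open>J\<close>, since only there can a constant be placed.\<close>

lemma glob_optimal_ge_constant:
  assumes "finite J" "0 \<in> J" and "f - const_poly c \<in> sos" and "glob_optimal f h J b"
  shows "c \<le> eval_poly (even_comb h J b) (round_vec h)"
proof -
  let ?b = "\<lambda>\<alpha>. if \<alpha> = 0 then c else 0"
  have "glob_feasible f h J ?b"
    using assms by (simp add: glob_feasible_def even_comb_constant zero_in_sos)
  then have "glob_objective h J ?b \<le> glob_objective h J b"
    using assms(4) by (simp add: glob_optimal_def)
  then show ?thesis
    using assms(1,2) by (simp add: even_comb_constant flip: eval_even_comb_round)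
qed

theorem theorem14:
  fixes f g :: "'n::finite rpoly" and h :: "real ^ 'n"
    and J :: "'n mindex set" and b :: "'n mindex \<Rightarrow> real"
  assumes "finite J"
    and "g = even_comb h J b"
    and "g \<in> C_set h"
    and "glob_feasible f h J b"
  shows "ereal (eval_poly g (round_vec h)) \<le> (INF x\<in>int_points. ereal (eval_poly f x)) \<and>
    (0 \<in> J \<and> f - const_poly (eval_poly f h) \<in> sos \<and> glob_optimal f h J b \<longrightarrow>
       eval_poly g (round_vec h) \<ge> eval_poly f h)"
proof (intro conjI impI INF_greatest)
  fix x :: "real ^ 'n" assume "x \<in> int_points"
  then show "ereal (eval_poly g (round_vec h)) \<le> ereal (eval_poly f x)"
    using glob_feasible_lower_bound assms(2,4) by simp
next
  assume "0 \<in> J \<and> f - const_poly (eval_poly f h) \<in> sos \<and> glob_optimal f h J b"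
  then show "eval_poly f h \<le> eval_poly g (round_vec h)"
    using glob_optimal_ge_constant assms(1,2) by blast
qed

end
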